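(* Let $\kappa$ be a positive integer. For every positive integer $L$ with prime factorization $L=\prod_{i=1}^{n}p_i^{\alpha_i}$ ($p_i$ distinct primes, $\alpha_i\ge1$), the set $$\bigcup_{M\in A_L}\mathfrak{B}_{M,\kappa}$$ is a basis for $V(L,\kappa)$. Moreover, $\dim V(L,\kappa)$ is a multiplicative function of $L$, and: (a) $\dim V(L,\kappa)=\prod_{i=1}^{n}\left(\phi(p_i^{\alpha_i})+1\right)$; (b) $\dim V(L,\kappa)=\sum_{M\in A_L}\phi(M)$; (c) in particular, $\dim V(L,\kappa)=L$ if and only if $L$ is square free.
   Context: $\mathcal{R}$ is the complex vector space of rational functions over $\mathbb{C}$ analytic at the origin, identified with their Taylor series; for each integer $n\ge1$, $U_n\left(\sum_{k\ge 0}a(k)x^k\right)=\sum_{k\ge 0}a(nk)x^k$. For positive integers $L,\kappa$, $$\mathcal{R}(L,\kappa)=\left\{f\in\mathcal{R}\mid f(x)=\sum_{k\ge0}k^{\kappa-1}a(k)x^k,\ a(k+L)=a(k)\text{ for all }k\ge 0\right\}$$ (with $0^0=1$). $V(L,\kappa)$ is the complex linear span of all simultaneous eigenfunctions in $\mathcal{R}(L,\kappa)$, i.e. of all $f\in\mathcal{R}(L,\kappa)$ such that for every integer $n\ge1$ there is $\lambda\in\mathbb{C}$ (possibly $\lambda=0$, and depending on $n$) with $U_nf=\lambda f$. $A_L$ is the set of unitary divisors of $L$: with $q_i=p_i^{\alpha_i}$, $A_L=\left\{\prod_{j\in S}q_j\mid S\subseteq\{1,\dots,n\}\right\}$ (the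 empty product being $1$). $\mathfrak{B}_{M,\kappa}$ is the set of the $\phi(M)$ functions $\sum_{k\ge0}\chi(k)k^{\kappa-1}x^k$, where $\chi$ ranges over the Dirichlet characters modulo $M$ (the unique character modulo $1$ is the constant function $1$, including at $0$). $\phi$ is Euler's totient function. A function $g$ on positive integers is multiplicative if $g(1)=1$ and $g(ab)=g(a)g(b)$ whenever $\gcd(a,b)=1$. *)

theory Defs
  imports
    "HOL-Computational_Algebra.Computational_Algebra"
    "HOL-Number_Theory.Totient"
begin

text \<open>
  A rational function over the complex numbers that is analytic at the origin is represented
  throughout by its Taylor series at the origin, an element of \<^typ>\<open>complex fps\<close>.
\<close>

definition fps_scale :: "complex \<Rightarrow> complex fps \<Rightarrow> complex fps" where
  "fps_scale c f = fps_const c * f"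

interpretation fps_vs: vector_space fps_scale
  by unfold_locales (simp_all add: fps_scale_def algebra_simps flip: fps_const_add)

definition is_basis :: "complex fps set \<Rightarrow> complex fps set \<Rightarrow> bool" where
  "is_basis B W \<longleftrightarrow> B \<subseteq> W \<and> fps_vs.independent B \<and> fps_vs.span B = W"

definition rational_fps :: "complex fps set" where
  "rational_fps = {fps_of_poly p / fps_of_poly q | p q. poly q 0 \<noteq> 0}"

definition U_op :: "nat \<Rightarrow> complex fps \<Rightarrow> complex fps" where
  "U_op n f = Abs_fps (\<lambda>k. fps_nth f (n * k))"

text \<open>
  The weight is \<open>k ^ (\<kappa> - 1)\<close> with \<open>\<kappa> \<ge> 1\<close>; for \<open>\<kappa> = 1\<close> the constant term is
  \<open>a 0\<close>, since \<open>0 ^ 0 = 1\<close>.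
\<close>

definition weighted_fps :: "nat \<Rightarrow> (nat \<Rightarrow> complex) \<Rightarrow> complex fps" where
  "weighted_fps \<kappa> a = Abs_fps (\<lambda>k. of_nat k ^ (\<kappa> - 1) * a k)"

definition R_space :: "nat \<Rightarrow> nat \<Rightarrow> complex fps set" where
  "R_space L \<kappa> = {f \<in> rational_fps. \<exists>a. f = weighted_fps \<kappa> a \<and> (\<forall>k. a (k + L) = a k)}"

definition V_space :: "nat \<Rightarrow> nat \<Rightarrow> complex fps set" where
  "V_space L \<kappa> = fps_vs.span
     {f \<in> R_space L \<kappa>. \<forall>n\<ge>1. \<exists>c. U_op n f = fps_scale c f}"

definition unitary_divisors :: "nat \<Rightarrow> nat set" where
  "unitary_divisors L = {\<Prod>p\<in>S. p ^ multiplicity p L | S. S \<subseteq> prime_factors L}"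

text \<open>
  Dirichlet characters, viewed as functions on the natural numbers. As \<open>gcd 0 1 = 1\<close>,
  the only character modulo 1 is the constant function 1, also at 0; for \<open>M > 1\<close> every
  character modulo \<open>M\<close> vanishes at 0.
\<close>

definition dirichlet_character :: "nat \<Rightarrow> (nat \<Rightarrow> complex) \<Rightarrow> bool" where
  "dirichlet_character M \<chi> \<longleftrightarrow>
     (\<forall>k. \<chi> (k + M) = \<chi> k) \<and>
     (\<forall>j k. \<chi> (j * k) = \<chi> j * \<chi> k) \<and>
     (\<forall>k. \<chi> k \<noteq> 0 \<longleftrightarrow> coprime k M)"

definition character_fps :: "nat \<Rightarrow> nat \<Rightarrow> complex fps set" where
  "character_fps M \<kappa> = {weighted_fps \<kappa> \<chi> | \<chi>. dirichlet_character M \<chi>}"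

definition multiplicative_on_pos :: "(nat \<Rightarrow> nat) \<Rightarrow> bool" where
  "multiplicative_on_pos g \<longleftrightarrow>
     g 1 = 1 \<and> (\<forall>a>0. \<forall>b>0. coprime a b \<longrightarrow> g (a * b) = g a * g b)"

end

theory Submission
  imports Defs "HOL-Number_Theory.Residues"
begin

text \<open>
  Let \<open>f\<close> have coefficients \<open>k ^ (\<kappa> - 1) * a k\<close> with \<open>a\<close> of period \<open>L\<close>, and let \<open>f\<close> be a nonzero
  eigenfunction of every \<open>U\<^sub>n\<close>. The coefficient of \<open>U\<^sub>n f\<close> at 1 is that of \<open>f\<close> at \<open>n\<close>, and
  by periodicity the coefficient at 0 is determined by the others, so the coefficient of \<open>f\<close> at 1
  cannot vanish; if it is scaled to 1, the eigenvalues are the coefficients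
  of \<open>f\<close>, and the eigenvalue equations say exactly that \<open>a\<close> is completely multiplicative.

  The arithmetic core is that such an \<open>a\<close> is a Dirichlet character modulo a unitary divisor of \<open>L\<close>
  (\<open>completely_multiplicative_periodic\<close>). Collect in \<open>M\<close> the full powers of those primes \<open>p\<close> dividing
  \<open>L\<close> for which \<open>a p = 0\<close>, and write \<open>L = N * M\<close>. Then \<open>a N \<noteq> 0\<close>, and cancelling \<open>a N\<close> in
  \<open>a N * a (k + M) = a (N * k + L) = a N * a k\<close> shows that \<open>a\<close> already has period \<open>M\<close>. By Euler's
  theorem \<open>a k\<close> is a root of unity for \<open>k\<close> coprime to \<open>M\<close>, and it is 0 for all other \<open>k\<close>.
  Conversely every character modulo a divisor of \<open>L\<close> gives an eigenfunction; it lies in the space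
  because the series is rational (\<open>weighted_fps_rational\<close>). Hence the characters span. They are
  independent because joint eigenvectors with different systems of eigenvalues are
  (\<open>independent_normalised_eigenforms\<close>).

  For the dimension one has to know that there are \<open>totient M\<close> characters modulo \<open>M\<close>
  (\<open>card_character_fps\<close>). The functions of period \<open>M\<close> supported on the residues coprime to \<open>M\<close> form
  a space of dimension \<open>totient M\<close>. On it the operators \<open>U\<^sub>n\<close> with \<open>n\<close> coprime to \<open>M\<close> commute and
  have finite order, so they are simultaneously diagonalisable (\<open>unit_periodic_simultaneous\<close>), and
  the joint eigenvectors are multiples of characters. Thus the characters form a basis of that space.
  Characters modulo different unitary divisors of \<open>L\<close> have different zeros, which gives the sum
  formula; expanding the product over the primes dividing \<open>L\<close> turns it into the product formula,
  from which multiplicativity and the criterion for dimension \<open>L\<close> are read off factor by factor.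
\<close>

section \<open>The operators \<open>U\<^sub>n\<close>\<close>

lemma fps_nth_scale [simp]: "fps_nth (fps_scale c f) n = c * fps_nth f n"
  by (simp add: fps_scale_def)

lemma fps_nth_U_op [simp]: "fps_nth (U_op n f) k = fps_nth f (n * k)"
  by (simp add: U_op_def)

lemma fps_nth_weighted [simp]: "fps_nth (weighted_fps \<kappa> a) k = of_nat k ^ (\<kappa> - 1) * a k"
  by (simp add: weighted_fps_def)

lemma U_op_add: "U_op n (f + g) = U_op n f + U_op n g"
  by (rule fps_ext) simp

lemma U_op_scale: "U_op n (fps_scale c f) = fps_scale c (U_op n f)"
  by (rule fps_ext) simp

lemma U_op_0 [simp]: "U_op n 0 = 0"
  by (rule fps_ext) simp

lemma U_op_1 [simp]: "U_op (Suc 0) f = f"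
  by (rule fps_ext) simp

lemma U_op_U_op: "U_op m (U_op n f) = U_op (m * n) f"
  by (rule fps_ext) (simp add: mult_ac)

lemma U_op_sum: "U_op n (sum f A) = (\<Sum>x\<in>A. U_op n (f x))"
  by (induction A rule: infinite_finite_induct) (simp_all add: U_op_add)

lemma weighted_fps_eqD:
  assumes "weighted_fps \<kappa> a = weighted_fps \<kappa> b" "k > 0"
  shows "a k = b k"
proof -
  have "of_nat k ^ (\<kappa> - 1) * a k = of_nat k ^ (\<kappa> - 1) * b k"
    using arg_cong[OF assms(1), of "\<lambda>f. fps_nth f k"] by simp
  then show ?thesis using assms(2) by simp
qed

section \<open>Series with periodic coefficients are rational\<close>

text \<open>Clearing the denominator avoids division of power series in the closure proofs below.\<close>
lemma rational_fps_iff: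
  "f \<in> rational_fps \<longleftrightarrow> (\<exists>p q. poly q 0 \<noteq> 0 \<and> f * fps_of_poly q = fps_of_poly p)"
proof -
  have "f = fps_of_poly p / fps_of_poly q \<longleftrightarrow> f * fps_of_poly q = fps_of_poly p"
    if "poly q 0 \<noteq> 0" for p q :: "complex poly"
  proof -
    have nz: "fps_nth (fps_of_poly q) 0 \<noteq> 0"
      using that by (simp add: poly_0_coeff_0)
    then have inv: "inverse (fps_of_poly q) * fps_of_poly q = 1"
      by (rule inverse_mult_eq_1)
    have "fps_of_poly p * inverse (fps_of_poly q) * fps_of_poly q = fps_of_poly p"
      by (simp add: inv mult.assoc)
    moreover have "f = f * fps_of_poly q * inverse (fps_of_poly q)"
      using inv by (simp add: mult.assoc mult.commute[of "fps_of_poly q"])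
    ultimately show ?thesis
      unfolding fps_divide_unit[OF nz] by metis
  qed
  then show ?thesis
    unfolding rational_fps_def by blast
qed

text \<open>
  The operator \<open>x d/dx\<close> multiplies the coefficient at \<open>k\<close> by \<open>k\<close>, so it raises the weight by one.
  If \<open>f q = p\<close>, then \<open>f' q\<^sup>2 = p' q - p q'\<close>.
\<close>
lemma rational_fps_X_deriv:
  assumes "f \<in> rational_fps"
  shows "fps_X * fps_deriv f \<in> rational_fps"
proof -
  obtain p q where q: "poly q 0 \<noteq> 0" and eq: "f * fps_of_poly q = fps_of_poly p"
    using assms by (auto simp: rational_fps_iff)
  have "fps_deriv f * fps_of_poly q + f * fps_deriv (fps_of_poly q) = fps_deriv (fps_of_poly p)"
    using arg_cong[OF eq, of fps_deriv] by (simp add: algebra_simps)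
  then have "fps_deriv f * fps_of_poly q =
      fps_deriv (fps_of_poly p) - f * fps_deriv (fps_of_poly q)"
    by (simp add: algebra_simps)
  then have "fps_X * fps_deriv f * (fps_of_poly q * fps_of_poly q) =
      fps_X * ((fps_deriv (fps_of_poly p) - f * fps_deriv (fps_of_poly q)) * fps_of_poly q)"
    by (simp only: mult.assoc) (simp only: mult.assoc[symmetric])
  also have "\<dots> = fps_X * (fps_deriv (fps_of_poly p) * fps_of_poly q
               - (f * fps_of_poly q) * fps_deriv (fps_of_poly q))"
    by (simp add: algebra_simps)
  also have "\<dots> = fps_of_poly ([:0, 1:] * (pderiv p * q - p * pderiv q))"
    by (simp only: eq fps_of_poly_mult fps_of_poly_diff fps_of_poly_pderiv fps_of_poly_fps_X)
  finally have "fps_X * fps_deriv f * fps_of_poly (q * q) = \<dots>"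
    by (simp only: fps_of_poly_mult)
  moreover have "poly (q * q) 0 \<noteq> 0"
    using q by simp
  ultimately show ?thesis
    unfolding rational_fps_iff by blast
qed

lemma weighted_fps_Suc_Suc:
  "weighted_fps (Suc (Suc m)) a = fps_X * fps_deriv (weighted_fps (Suc m) a)"
proof (rule fps_ext)
  fix n show "fps_nth (weighted_fps (Suc (Suc m)) a) n =
      fps_nth (fps_X * fps_deriv (weighted_fps (Suc m) a)) n"
    by (cases n) (simp_all add: fps_X_mult_nth)
qed

text \<open>Multiplication by \<open>1 - x ^ L\<close> leaves only the coefficients of the first period.\<close>
lemma weighted_fps_1_rational:
  assumes "L > 0" "\<And>k. a (k + L) = a k"
  shows "weighted_fps (Suc 0) a \<in> rational_fps"
proof -
  define q :: "complex poly" where "q = 1 - Polynomial.monom 1 L"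
  define p where "p = (\<Sum>k<L. Polynomial.monom (a k) k)"
  have "weighted_fps (Suc 0) a * fps_of_poly q = fps_of_poly p"
  proof (rule fps_ext)
    fix n
    have "weighted_fps (Suc 0) a * fps_of_poly q =
        weighted_fps (Suc 0) a - weighted_fps (Suc 0) a * fps_X ^ L"
      by (simp add: q_def fps_of_poly_diff fps_of_poly_monom' algebra_simps)
    moreover have "a (n - L) = a n" if "n \<ge> L"
      using assms(2)[of "n - L"] that by simp
    ultimately show "fps_nth (weighted_fps (Suc 0) a * fps_of_poly q) n = fps_nth (fps_of_poly p) n"
      by (auto simp: p_def fps_X_power_mult_right_nth coeff_sum)
  qed
  moreover have "poly q 0 \<noteq> 0"
    using assms(1) by (simp add: q_def poly_monom power_0_left)
  ultimately show ?thesis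
    unfolding rational_fps_iff by blast
qed

lemma weighted_fps_rational:
  assumes "L > 0" "\<And>k. a (k + L) = a k"
  shows "weighted_fps \<kappa> a \<in> rational_fps"
proof -
  have "weighted_fps (Suc m) a \<in> rational_fps" for m
    by (induction m)
       (use weighted_fps_1_rational[of L a] assms in \<open>auto simp: weighted_fps_Suc_Suc intro: rational_fps_X_deriv\<close>)
  moreover have "weighted_fps 0 a = weighted_fps (Suc 0) a"
    by (simp add: weighted_fps_def)
  ultimately show ?thesis
    by (cases \<kappa>) auto
qed

lemma R_space_iff:
  assumes "L > 0"
  shows "f \<in> R_space L \<kappa> \<longleftrightarrow> (\<exists>a. f = weighted_fps \<kappa> a \<and> (\<forall>k. a (k + L) = a k))"
  using weighted_fps_rational[OF assms] by (auto simp: R_space_def)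

section \<open>Linear independence of eigenforms\<close>

text \<open>
  When the coefficient at 1 is 1, comparing coefficients at 1 shows that the eigenvalue of \<open>U\<^sub>n\<close>
  can only be the coefficient at \<open>n\<close>; the definition therefore names it instead of quantifying over it.
\<close>
definition normalised_eigenform :: "complex fps \<Rightarrow> bool" where
  "normalised_eigenform f \<longleftrightarrow>
     fps_nth f 1 = 1 \<and> (\<forall>n\<ge>1. U_op n f = fps_scale (fps_nth f n) f)"

text \<open>
  Dedekind's argument for the independence of characters. The second hypothesis says that different
  members have different systems of eigenvalues. It does not follow from the first: both \<open>1 / (1 - x)\<close>
  and its sum with any nonzero constant are normalised eigenforms with all eigenvalues equal to 1.
\<close>
lemma independent_normalised_eigenforms:
  assumes eig: "\<And>f. f \<in> B \<Longrightarrow> normalised_eigenform f"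
    and dist: "\<And>f g. f \<in> B \<Longrightarrow> g \<in> B \<Longrightarrow> (\<And>n. n \<ge> 1 \<Longrightarrow> fps_nth f n = fps_nth g n) \<Longrightarrow> f = g"
  shows "fps_vs.independent B"
  unfolding fps_vs.independent_explicit_finite_subsets
proof (intro allI impI)
  fix S and u :: "complex fps \<Rightarrow> complex"
  assume "S \<subseteq> B" "finite S" and "(\<Sum>v\<in>S. fps_scale (u v) v) = 0"
  from this(2,1,3) show "\<forall>v\<in>S. u v = 0"
  proof (induction S arbitrary: u rule: finite_induct)
    case (insert f S)
    have U: "U_op n g = fps_scale (fps_nth g n) g" if "n \<ge> 1" "g \<in> insert f S" for n g
      using that eig insert.prems(1) unfolding normalised_eigenform_def by blast
    have rel: "fps_scale (u f) f + (\<Sum>v\<in>S. fps_scale (u v) v) = 0"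
      using insert.prems(2) insert.hyps by simp
    have S0: "u g = 0" if g: "g \<in> S" for g
    proof -
      have "g \<noteq> f" using g insert.hyps by blast
      then obtain n where n: "n \<ge> 1" "fps_nth f n \<noteq> fps_nth g n"
        using dist[of f g] g insert.prems(1) by blast
      \<comment> \<open>Applying \<open>U\<^sub>n\<close> and subtracting the multiple by the eigenvalue of \<open>f\<close> eliminates \<open>f\<close>.\<close>
      have "(\<Sum>v\<in>S. fps_scale (u v * (fps_nth v n - fps_nth f n)) v) =
          U_op n (fps_scale (u f) f + (\<Sum>v\<in>S. fps_scale (u v) v))
          - fps_scale (fps_nth f n) (fps_scale (u f) f + (\<Sum>v\<in>S. fps_scale (u v) v))"
        using U n(1)
        by (simp add: U_op_add U_op_sum U_op_scale fps_vs.scale_right_distrib fps_vs.scale_sum_right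
            fps_vs.scale_left_diff_distrib right_diff_distrib sum_subtractf mult_ac)
      also have "\<dots> = 0"
        unfolding rel by simp
      finally have "u g * (fps_nth g n - fps_nth f n) = 0"
        using insert.IH[of "\<lambda>v. u v * (fps_nth v n - fps_nth f n)"] insert.prems(1) g by blast
      with n(2) show ?thesis by simp
    qed
    then have "fps_scale (u f) f = 0"
      using rel by simp
    moreover have "fps_nth f 1 = 1"
      using eig insert.prems(1) by (auto simp: normalised_eigenform_def)
    ultimately have "u f = 0"
      using fps_nth_scale[of "u f" f 1] by (metis fps_zero_nth mult_1_right)
    with S0 show ?case by blast
  qed simp
qed

section \<open>Eigenforms and Dirichlet characters\<close>

lemma periodic_cong:
  fixes a :: "nat \<Rightarrow> 'a"
  assumes "\<And>k. a (k + L) = a k" "[j = k] (mod L)"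
  shows "a j = a k"
proof -
  have "a (k + m * L) = a k" for k m
    by (induction m) (simp, metis assms(1) add.assoc add.commute mult_Suc)
  then have "a k = a (k mod L)" for k
    by (metis mod_mult_div_eq mult.commute)
  then show ?thesis
    using assms(2) unfolding cong_def by metis
qed

text \<open>
  The values at arguments coprime to \<open>M\<close> are roots of unity by Euler's theorem, so vanishing at the
  primes dividing \<open>M\<close> is all that has to be checked about the support.
\<close>
lemma dirichlet_characterI:
  assumes "M > 0" and per: "\<And>k. \<chi> (k + M) = \<chi> k"
    and mult: "\<And>j k. \<chi> (j * k) = \<chi> j * \<chi> k" and one: "\<chi> 1 = 1"
    and zero: "\<And>p. prime p \<Longrightarrow> p dvd M \<Longrightarrow> \<chi> p = 0"
  shows "dirichlet_character M \<chi>"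
  unfolding dirichlet_character_def
proof (intro conjI allI)
  fix k
  show "\<chi> k \<noteq> 0 \<longleftrightarrow> coprime k M"
  proof
    assume *: "\<chi> k \<noteq> 0"
    show "coprime k M"
    proof (rule ccontr)
      assume "\<not> coprime k M"
      then have "gcd k M \<noteq> 1"
        by (simp add: coprime_iff_gcd_eq_1)
      then obtain p where p: "prime p" "p dvd k" "p dvd M"
        using prime_factor_nat[of "gcd k M"] by auto
      then show False
        using * zero[OF p(1,3)] by (auto simp: mult elim!: dvdE)
    qed
  next
    assume "coprime k M"
    then have "[k ^ totient M = 1] (mod M)"
      by (rule euler_theorem)
    then have "\<chi> (k ^ totient M) = 1"
      using periodic_cong[of \<chi> M, OF per] one by metis
    moreover have "\<chi> (k ^ m) = \<chi> k ^ m" for m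
      by (induction m) (use one in \<open>simp_all add: mult\<close>)
    moreover have "totient M > 0"
      using \<open>M > 0\<close> by simp
    ultimately show "\<chi> k \<noteq> 0"
      by (metis power_0_left neq0_conv zero_neq_one)
  qed
qed (simp_all add: per mult)

lemma dirichlet_character_1:
  assumes "dirichlet_character M \<chi>"
  shows "\<chi> 1 = 1"
proof -
  have "\<chi> 1 \<noteq> 0" "\<chi> (1 * 1) = \<chi> 1 * \<chi> 1"
    using assms unfolding dirichlet_character_def by (simp, blast)
  then show ?thesis by simp
qed

lemma normalised_eigenform_character:
  assumes "dirichlet_character M \<chi>"
  shows "normalised_eigenform (weighted_fps \<kappa> \<chi>)"
  using assms dirichlet_character_1[OF assms]
  unfolding normalised_eigenform_def dirichlet_character_def
  by (auto simp: fps_eq_iff power_mult_distrib)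

text \<open>
  For positive arguments this is a comparison of the coefficients at \<open>k\<close> in the equation for \<open>U\<^sub>j\<close>. For \<open>\<kappa> > 1\<close> the
  factor \<open>k ^ (\<kappa> - 1)\<close> hides the value \<open>a 0\<close>, which only periodicity recovers.
\<close>
lemma normalised_eigenform_multiplicative:
  assumes L: "L > 0" and per: "\<And>k. a (k + L) = a k" and f: "normalised_eigenform (weighted_fps \<kappa> a)"
  shows "a 1 = 1" "a (j * k) = a j * a k"
proof -
  show "a 1 = 1"
    using f by (simp add: normalised_eigenform_def)
  have *: "a (n * k) = a n * a k" if "n > 0" "k > 0" for n k
  proof -
    have "fps_nth (U_op n (weighted_fps \<kappa> a)) k =
        fps_nth (fps_scale (fps_nth (weighted_fps \<kappa> a) n) (weighted_fps \<kappa> a)) k"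
      using f that by (simp add: normalised_eigenform_def)
    then have "(of_nat n * of_nat k) ^ (\<kappa> - 1) * a (n * k) = (of_nat n * of_nat k) ^ (\<kappa> - 1) * (a n * a k)"
      by (simp add: power_mult_distrib mult_ac)
    then show ?thesis using that by simp
  qed
  have "[j * k = (j + L) * (k + L)] (mod L)"
    by (intro cong_mult) (auto simp: cong_def)
  then have "a (j * k) = a ((j + L) * (k + L))"
    by (rule periodic_cong[of a L, OF per])
  also have "\<dots> = a j * a k"
    using *[of "j + L" "k + L"] L by (simp add: per)
  finally show "a (j * k) = a j * a k" .
qed

section \<open>Unitary divisors as periods\<close>

definition unitary_part :: "nat \<Rightarrow> nat set \<Rightarrow> nat" where
  "unitary_part L S = (\<Prod>p\<in>S. p ^ multiplicity p L)"

lemma unitary_divisors_altdef: "unitary_divisors L = unitary_part L ` Pow (prime_factors L)"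
  by (auto simp: unitary_divisors_def unitary_part_def)

lemma unitary_part_pos: "S \<subseteq> prime_factors L \<Longrightarrow> unitary_part L S > 0"
  unfolding unitary_part_def by (rule prod_pos) (auto simp: in_prime_factors_iff prime_gt_0_nat)

lemma prime_dvd_unitary_part_iff:
  assumes S: "S \<subseteq> prime_factors L" and p: "prime p"
  shows "p dvd unitary_part L S \<longleftrightarrow> p \<in> S"
proof -
  have "finite S" using S by (rule finite_subset) simp
  then have "p dvd unitary_part L S \<longleftrightarrow> (\<exists>q\<in>S. p dvd q ^ multiplicity q L)"
    unfolding unitary_part_def using p by (rule prime_dvd_prod_iff)
  also have "\<dots> \<longleftrightarrow> p \<in> S"
  proof
    assume "\<exists>q\<in>S. p dvd q ^ multiplicity q L"
    then obtain q where q: "q \<in> S" "p dvd q"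
      using p prime_dvd_power by blast
    then show "p \<in> S"
      using S p primes_dvd_imp_eq[of p q] by (auto simp: in_prime_factors_iff subset_iff)
  next
    assume "p \<in> S"
    moreover from this have "multiplicity p L > 0"
      using S by (auto simp: prime_factors_multiplicity subset_iff)
    ultimately show "\<exists>q\<in>S. p dvd q ^ multiplicity q L"
      by (auto intro: dvd_power)
  qed
  finally show ?thesis .
qed

lemma unitary_part_complement:
  assumes "L > 0" and S: "S \<subseteq> prime_factors L"
  shows "unitary_part L S * unitary_part L (prime_factors L - S) = L"
proof -
  have "unitary_part L (prime_factors L) = L"
    unfolding unitary_part_def using prime_factorization_nat[OF assms(1)] by simp
  then show "unitary_part L S * unitary_part L (prime_factors L - S) = L"
    unfolding unitary_part_def using prod.subset_diff[OF S, of "\<lambda>p. p ^ multiplicity p L"]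
    by (simp add: mult.commute)
qed

lemma inj_on_unitary_part: "inj_on (unitary_part L) (Pow (prime_factors L))"
proof (rule inj_onI)
  fix S T assume ST: "S \<in> Pow (prime_factors L)" "T \<in> Pow (prime_factors L)"
    and eq: "unitary_part L S = unitary_part L T"
  have "p \<in> S \<longleftrightarrow> p \<in> T" if "p \<in> prime_factors L" for p
    using prime_dvd_unitary_part_iff[of S L p] prime_dvd_unitary_part_iff[of T L p] ST eq that
    by (simp add: in_prime_factors_iff)
  then show "S = T"
    using ST by blast
qed

text \<open>
  The primes dividing \<open>L\<close> at which \<open>a\<close> vanishes determine the modulus: the part of \<open>L\<close> made up of
  the other primes can be cancelled from the period because \<open>a\<close> does not vanish there.
\<close>
theorem completely_multiplicative_periodic:
  assumes L: "L > 0" and per: "\<And>k. a (k + L) = a k"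
    and mult: "\<And>j k. a (j * k) = a j * a k" and one: "a 1 = 1"
  shows "\<exists>M\<in>unitary_divisors L. dirichlet_character M a"
proof -
  define S where "S = {p \<in> prime_factors L. a p = 0}"
  define M where "M = unitary_part L S"
  define N where "N = unitary_part L (prime_factors L - S)"
  have S: "S \<subseteq> prime_factors L" by (auto simp: S_def)
  have MN: "N * M = L"
    unfolding M_def N_def using unitary_part_complement[OF L S] by (simp add: mult.commute)
  have pow: "a (k ^ m) = a k ^ m" for k m
    by (induction m) (use one in \<open>simp_all add: mult\<close>)
  have "a (unitary_part L T) = (\<Prod>p\<in>T. a p ^ multiplicity p L)" if "finite T" for T
    using that by (induction T rule: finite_induct) (use one in \<open>simp_all add: unitary_part_def mult pow\<close>)
  then have N0: "a N \<noteq> 0"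
    by (auto simp: N_def S_def)
  have "a (k + M) = a k" for k
  proof -
    have "a N * a (k + M) = a (N * k + L)"
      using MN by (simp add: distrib_left flip: mult)
    also have "\<dots> = a N * a k"
      by (simp add: per mult)
    finally show ?thesis using N0 by simp
  qed
  moreover have "a p = 0" if "prime p" "p dvd M" for p
    using prime_dvd_unitary_part_iff[OF S that(1)] that(2) by (auto simp: M_def S_def)
  moreover have "M > 0"
    using unitary_part_pos[OF S] by (simp add: M_def)
  ultimately have "dirichlet_character M a"
    using mult one by (intro dirichlet_characterI)
  moreover have "M \<in> unitary_divisors L"
    using S by (auto simp: M_def unitary_divisors_altdef)
  ultimately show ?thesis by blast
qed

section \<open>Joint eigenfunctions with periodic coefficients\<close>

lemma periodic_lift_dvd:
  fixes a :: "nat \<Rightarrow> 'a"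
  assumes "\<And>k. a (k + M) = a k" "M dvd L"
  shows "a (k + L) = a k"
  by (rule periodic_cong[of a M]) (use assms in \<open>auto simp: cong_def elim!: dvdE\<close>)

lemma character_fps_subset_R_space:
  assumes "L > 0" "M dvd L"
  shows "character_fps M \<kappa> \<subseteq> R_space L \<kappa>"
proof
  fix f assume "f \<in> character_fps M \<kappa>"
  then obtain \<chi> where "f = weighted_fps \<kappa> \<chi>" "\<And>k. \<chi> (k + M) = \<chi> k"
    by (auto simp: character_fps_def dirichlet_character_def)
  then show "f \<in> R_space L \<kappa>"
    using periodic_lift_dvd[of \<chi> M L] assms by (auto simp: R_space_iff)
qed

text \<open>The coefficient at 0 is determined by the one at \<open>L\<close>, since the factor \<open>a\<close> repeats there.\<close>
lemma R_space_eqI: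
  assumes L: "L > 0" and f: "f \<in> R_space L \<kappa>" and g: "g \<in> R_space L \<kappa>"
    and eq: "\<And>n. n \<ge> 1 \<Longrightarrow> fps_nth f n = fps_nth g n"
  shows "f = g"
proof -
  obtain a b where f': "f = weighted_fps \<kappa> a" "\<And>k. a (k + L) = a k"
    and g': "g = weighted_fps \<kappa> b" "\<And>k. b (k + L) = b k"
    using f g by (auto simp: R_space_iff[OF L])
  have "a (k + L) = b (k + L)" for k
  proof -
    have "of_nat (k + L) ^ (\<kappa> - 1) * a (k + L) = of_nat (k + L) ^ (\<kappa> - 1) * b (k + L)"
      using eq[of "k + L"] L by (simp only: f'(1) g'(1) fps_nth_weighted)
    moreover have "of_nat (k + L) \<noteq> (0 :: complex)"
      using L by (simp only: of_nat_eq_0_iff)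
    ultimately show ?thesis
      by simp
  qed
  then have "a = b"
    by (simp add: f' g' fun_eq_iff)
  then show ?thesis
    by (simp add: f' g')
qed

lemma R_space_scale:
  assumes "L > 0" "f \<in> R_space L \<kappa>"
  shows "fps_scale c f \<in> R_space L \<kappa>"
proof -
  obtain a where "f = weighted_fps \<kappa> a" "\<And>k. a (k + L) = a k"
    using assms by (auto simp: R_space_iff)
  then have "fps_scale c f = weighted_fps \<kappa> (\<lambda>k. c * a k)" "\<And>k. c * a (k + L) = c * a k"
    by (auto simp: fps_eq_iff)
  then show ?thesis
    using assms(1) unfolding R_space_iff[OF assms(1)] by blast
qed

lemma zero_in_R_space: "L > 0 \<Longrightarrow> 0 \<in> R_space L \<kappa>"
  by (auto simp: R_space_iff fps_eq_iff intro!: exI[of _ "\<lambda>_. 0"])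

lemma eigenvalue_times_first_coefficient:
  assumes "U_op n f = fps_scale c f"
  shows "fps_nth f n = c * fps_nth f 1"
  using arg_cong[OF assms, of "\<lambda>g. fps_nth g 1"] by simp

lemma normalise_joint_eigenfunction:
  assumes "\<forall>n\<ge>1. \<exists>c. U_op n f = fps_scale c f" "fps_nth f 1 \<noteq> 0"
  shows "normalised_eigenform (fps_scale (1 / fps_nth f 1) f)"
  unfolding normalised_eigenform_def
proof (intro conjI allI impI)
  fix n :: nat assume "n \<ge> 1"
  then obtain c where c: "U_op n f = fps_scale c f"
    using assms(1) by blast
  have "fps_nth (fps_scale (1 / fps_nth f 1) f) n = c"
    using assms(2) eigenvalue_times_first_coefficient[OF c] by simp
  then show "U_op n (fps_scale (1 / fps_nth f 1) f) =
      fps_scale (fps_nth (fps_scale (1 / fps_nth f 1) f) n) (fps_scale (1 / fps_nth f 1) f)"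
    by (simp only: U_op_scale c fps_vs.scale_left_commute)
qed (use assms(2) in simp)

lemma joint_eigenfunction_eq_0:
  assumes "\<forall>n\<ge>1. \<exists>c. U_op n f = fps_scale c f" "fps_nth f 1 = 0" "L > 0" "f \<in> R_space L \<kappa>"
  shows "f = 0"
proof (rule R_space_eqI[OF assms(3,4) zero_in_R_space[OF assms(3)]])
  fix n :: nat assume "n \<ge> 1"
  then obtain c where "U_op n f = fps_scale c f"
    using assms(1) by blast
  then show "fps_nth f n = fps_nth 0 n"
    using eigenvalue_times_first_coefficient assms(2) by fastforce
qed

lemma independent_character_fps:
  assumes "M > 0"
  shows "fps_vs.independent (character_fps M \<kappa>)"
proof (rule independent_normalised_eigenforms)
  fix f g assume "f \<in> character_fps M \<kappa>" "g \<in> character_fps M \<kappa>"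
    and eq: "\<And>n. n \<ge> 1 \<Longrightarrow> fps_nth f n = fps_nth g n"
  then show "f = g"
    using character_fps_subset_R_space[OF assms dvd_refl, of \<kappa>] R_space_eqI[OF assms, of f \<kappa> g] by blast
qed (auto simp: character_fps_def normalised_eigenform_character)

section \<open>The number of Dirichlet characters\<close>

text \<open>
  Functions on the unit group of the integers modulo \<open>M\<close>, extended by 0 and stored as the coefficients
  of a power series, so that \<open>U\<^sub>n\<close> becomes translation by \<open>n\<close>. Weight \<open>\<kappa> = 1\<close> is the one in which
  these translations have finite order; the number of characters does not depend on the weight.
\<close>
definition unit_periodic :: "nat \<Rightarrow> complex fps set" where
  "unit_periodic M = {f. (\<forall>k. fps_nth f (k + M) = fps_nth f k) \<and>
     (\<forall>k. \<not> coprime k M \<longrightarrow> fps_nth f k = 0)}"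

lemma subspace_unit_periodic: "fps_vs.subspace (unit_periodic M)"
  by (rule fps_vs.subspaceI) (auto simp: unit_periodic_def)

lemma unit_periodic_cong:
  assumes "f \<in> unit_periodic M" "[j = k] (mod M)"
  shows "fps_nth f j = fps_nth f k"
proof (rule periodic_cong[OF _ assms(2)])
  show "fps_nth f (k + M) = fps_nth f k" for k
    using assms(1) by (simp add: unit_periodic_def)
qed

lemma U_op_unit_periodic_cong:
  assumes "f \<in> unit_periodic M" "[m = n] (mod M)"
  shows "U_op m f = U_op n f"
  by (rule fps_ext) (use assms in \<open>auto intro!: unit_periodic_cong cong_mult\<close>)

lemma U_op_unit_periodic:
  assumes "f \<in> unit_periodic M"
  shows "U_op n f \<in> unit_periodic M"
proof -
  have "fps_nth f (n * (k + M)) = fps_nth f (n * k)" for k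
    by (rule unit_periodic_cong[OF assms]) (auto simp: cong_def distrib_left)
  then show ?thesis
    using assms by (auto simp: unit_periodic_def)
qed

text \<open>
  An operator of finite order \<open>N\<close> is diagonalisable: with \<open>\<zeta>\<close> a primitive \<open>N\<close>-th root of
  unity, the sum \<open>P i\<close> of \<open>\<zeta> ^ (i * j) U ^ j f\<close> over \<open>j < N\<close> lies in the eigenspace of \<open>\<zeta> ^ (- i)\<close>,
  and the \<open>P i\<close> add up to \<open>N f\<close> by orthogonality of the powers of \<open>\<zeta>\<close>. The space \<open>W\<close> is general so that the
  lemma can be applied inside a joint eigenspace of other operators.
\<close>
lemma finite_order_spectral:
  assumes W: "fps_vs.subspace W" and inv: "\<And>f. f \<in> W \<Longrightarrow> U_op m f \<in> W"
    and f: "f \<in> W" and N: "N > 0" and ord: "U_op (m ^ N) f = f"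
  shows "f \<in> fps_vs.span {g \<in> W. \<exists>c. U_op m g = fps_scale c g}"
proof -
  define \<zeta> where "\<zeta> = cis (2 * pi / real N)"
  have \<zeta>_pow: "\<zeta> ^ j = cis (2 * pi * real j / real N)" for j
    by (simp add: \<zeta>_def DeMoivre mult_ac)
  have \<zeta>N: "\<zeta> ^ N = 1"
    using N by (simp add: \<zeta>_pow)
  have \<zeta>0: "\<zeta> \<noteq> 0"
    by (simp add: \<zeta>_def)
  have \<zeta>j: "\<zeta> ^ j \<noteq> 1" if "0 < j" "j < N" for j
  proof
    assume "\<zeta> ^ j = 1"
    then have "cis (2 * pi * real j / real N) = cis (2 * pi * real 0 / real N)"
      by (simp add: \<zeta>_pow)
    from inj_onD[OF bij_betw_imp_inj_on[OF bij_betw_roots_unity[OF N]] this] that N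
    show False by simp
  qed
  have orth: "(\<Sum>i<N. \<zeta> ^ (i * j)) = (if j = 0 then of_nat N else 0)" if "j < N" for j
  proof (cases "j = 0")
    case False
    have "(\<Sum>i<N. \<zeta> ^ (i * j)) = (\<Sum>i<N. (\<zeta> ^ j) ^ i)"
      by (simp add: mult.commute flip: power_mult)
    also have "\<dots> = ((\<zeta> ^ j) ^ N - 1) / (\<zeta> ^ j - 1)"
      using False that \<zeta>j by (intro geometric_sum) simp
    also have "(\<zeta> ^ j) ^ N = 1"
      using \<zeta>N by (metis mult.commute power_mult power_one)
    finally show ?thesis using False by simp
  qed simp
  define P where "P i = (\<Sum>j<N. fps_scale (\<zeta> ^ (i * j)) (U_op (m ^ j) f))" for i
  have UW: "U_op (m ^ j) f \<in> W" for j
    by (induction j) (use f inv in \<open>auto simp flip: U_op_U_op\<close>)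
  have P_W: "P i \<in> W" for i
    unfolding P_def using W UW by (intro fps_vs.subspace_sum fps_vs.subspace_scale)
  have P_eig: "U_op m (P i) = fps_scale (inverse (\<zeta> ^ i)) (P i)" for i
  proof -
    \<comment> \<open>The summands \<open>h j\<close> are periodic in \<open>j\<close>, and \<open>\<zeta> ^ i * U\<close> shifts them by one.\<close>
    define h where "h j = fps_scale (\<zeta> ^ (i * j)) (U_op (m ^ j) f)" for j
    have "h N = h 0"
      using ord \<zeta>N by (simp add: h_def power_mult mult.commute[of i])
    then have shift: "(\<Sum>j<N. h (Suc j)) = (\<Sum>j<N. h j)"
      using sum.lessThan_Suc_shift[of h N] sum.lessThan_Suc[of h N] by (simp add: add.commute)
    have "fps_scale (\<zeta> ^ i) (U_op m (P i)) = (\<Sum>j<N. h (Suc j))"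
      by (simp add: P_def h_def U_op_sum U_op_scale U_op_U_op fps_vs.scale_sum_right power_add)
    also have "\<dots> = P i"
      unfolding shift by (simp add: P_def h_def)
    finally have "fps_scale (inverse (\<zeta> ^ i)) (fps_scale (\<zeta> ^ i) (U_op m (P i))) =
        fps_scale (inverse (\<zeta> ^ i)) (P i)"
      by simp
    then show ?thesis
      using \<zeta>0 by simp
  qed
  have "(\<Sum>i<N. P i) = (\<Sum>j<N. \<Sum>i<N. fps_scale (\<zeta> ^ (i * j)) (U_op (m ^ j) f))"
    unfolding P_def by (rule sum.swap)
  also have "\<dots> = (\<Sum>j<N. fps_scale (\<Sum>i<N. \<zeta> ^ (i * j)) (U_op (m ^ j) f))"
    by (simp add: fps_vs.scale_sum_left)
  also have "\<dots> = (\<Sum>j<N. if j = 0 then fps_scale (of_nat N) f else 0)"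
    by (intro sum.cong) (auto simp: orth)
  also have "\<dots> = fps_scale (of_nat N) f"
    using N by simp
  finally have "f = fps_scale (inverse (of_nat N)) (\<Sum>i<N. P i)"
    using N by simp
  moreover have "(\<Sum>i<N. P i) \<in> fps_vs.span {g \<in> W. \<exists>c. U_op m g = fps_scale c g}"
    using P_W P_eig by (intro fps_vs.span_sum fps_vs.span_base) blast
  then have "fps_scale (inverse (of_nat N)) (\<Sum>i<N. P i)
      \<in> fps_vs.span {g \<in> W. \<exists>c. U_op m g = fps_scale c g}"
    by (rule fps_vs.span_scale)
  ultimately show ?thesis
    by simp
qed

text \<open>
  Commuting diagonalisable operators are simultaneously diagonalisable: the joint eigenspace \<open>W\<close>
  of the operators treated so far is invariant under the next one, which has order dividing
  \<open>totient M\<close> by Euler's theorem, and splits further inside \<open>W\<close>.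
\<close>
lemma unit_periodic_simultaneous:
  assumes M: "M > 0" and "finite A" "\<And>n. n \<in> A \<Longrightarrow> coprime n M"
  shows "unit_periodic M \<subseteq>
    fps_vs.span {g \<in> unit_periodic M. \<forall>n\<in>A. \<exists>c. U_op n g = fps_scale c g}"
  using assms(2,3)
proof (induction A rule: finite_induct)
  case empty
  show ?case by (auto intro: fps_vs.span_base)
next
  case (insert m A)
  let ?E = "\<lambda>A. {g \<in> unit_periodic M. \<forall>n\<in>A. \<exists>c. U_op n g = fps_scale c g}"
  have "?E A \<subseteq> fps_vs.span (?E (insert m A))"
  proof
    fix g assume g: "g \<in> ?E A"
    then obtain c where c: "\<And>n. n \<in> A \<Longrightarrow> U_op n g = fps_scale (c n) g"
      by (auto simp: bchoice_iff)
    define W where "W = {h \<in> unit_periodic M. \<forall>n\<in>A. U_op n h = fps_scale (c n) h}"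
    have "fps_vs.subspace W"
      using subspace_unit_periodic[of M]
      by (auto simp: W_def fps_vs.subspace_def U_op_add U_op_scale fps_vs.scale_right_distrib mult.commute)
    moreover have "U_op m h \<in> W" if "h \<in> W" for h
    proof -
      have "U_op n (U_op m h) = fps_scale (c n) (U_op m h)" if "n \<in> A" for n
      proof -
        have "U_op n (U_op m h) = U_op m (U_op n h)"
          by (simp add: U_op_U_op mult.commute)
        then show ?thesis
          using \<open>h \<in> W\<close> that by (simp add: W_def U_op_scale)
      qed
      then show ?thesis
        using that U_op_unit_periodic by (simp add: W_def)
    qed
    moreover have "g \<in> W"
      using g c by (simp add: W_def)
    moreover have "U_op (m ^ totient M) g = g"
      using U_op_unit_periodic_cong[of g M "m ^ totient M" 1] g euler_theorem[of m M] insert.prems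
      by simp
    moreover have "totient M > 0"
      using M by simp
    ultimately have "g \<in> fps_vs.span {h \<in> W. \<exists>c. U_op m h = fps_scale c h}"
      by (intro finite_order_spectral)
    also have "\<dots> \<subseteq> fps_vs.span (?E (insert m A))"
      by (intro fps_vs.span_mono) (auto simp: W_def)
    finally show "g \<in> fps_vs.span (?E (insert m A))" .
  qed
  then have "fps_vs.span (?E A) \<subseteq> fps_vs.span (?E (insert m A))"
    by (intro fps_vs.span_minimal) auto
  with insert show ?case by blast
qed

text \<open>
  Totatives are taken from \<open>{0<..M}\<close>, so for \<open>M = 1\<close> the representative is 1 and not the remainder 0.
\<close>
lemma totative_representative:
  assumes "M > 0" "coprime n M"
  obtains r where "r \<in> totatives M" "[n = r] (mod M)"
proof
  define r where "r = (if n mod M = 0 then M else n mod M)"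
  show *: "[n = r] (mod M)"
    by (simp add: r_def cong_def)
  have "coprime r M"
    using cong_imp_coprime[OF *] assms(2) by simp
  then show "r \<in> totatives M"
    using assms(1) by (auto simp: r_def in_totatives_iff intro: less_imp_le)
qed

lemma totatives_cong_unique:
  assumes "r \<in> totatives M" "s \<in> totatives M" "[r = s] (mod M)"
  shows "r = s"
  using assms by (cases "r = M"; cases "s = M") (auto simp: in_totatives_iff cong_def)

lemma character_fps_subset_unit_periodic: "character_fps M 1 \<subseteq> unit_periodic M"
  by (auto simp: character_fps_def dirichlet_character_def unit_periodic_def)

text \<open>
  A joint eigenvector of the translations by units is an eigenfunction of all \<open>U\<^sub>n\<close>, because \<open>U\<^sub>n\<close>
  depends only on \<open>n\<close> modulo \<open>M\<close> and is 0 on this space for \<open>n\<close> not coprime to \<open>M\<close>. It vanishes if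
  its coefficient at 1 does, and otherwise a multiple of it is a character.
\<close>
lemma unit_periodic_subset_span_characters:
  assumes M: "M > 0"
  shows "unit_periodic M \<subseteq> fps_vs.span (character_fps M 1)"
proof -
  let ?E = "{g \<in> unit_periodic M. \<forall>n\<in>totatives M. \<exists>c. U_op n g = fps_scale c g}"
  have "g \<in> fps_vs.span (character_fps M 1)" if g: "g \<in> ?E" for g
  proof (cases "fps_nth g 1 = 0")
    case False
    define h where "h = fps_scale (1 / fps_nth g 1) g"
    have "\<exists>c. U_op n g = fps_scale c g" for n
    proof (cases "coprime n M")
      case True
      then obtain r where "r \<in> totatives M" "[n = r] (mod M)"
        using totative_representative M by blast
      then show ?thesis
        using g U_op_unit_periodic_cong[of g M n r] by auto
    next
      case False
      then have "U_op n g = fps_scale 0 g"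
        using g by (auto simp: fps_eq_iff unit_periodic_def)
      then show ?thesis by blast
    qed
    then have norm: "normalised_eigenform h"
      unfolding h_def using False by (intro normalise_joint_eigenfunction) auto
    have h_eq: "h = weighted_fps 1 (fps_nth h)"
      by (simp add: fps_eq_iff)
    have h: "h \<in> unit_periodic M"
      unfolding h_def using g subspace_unit_periodic by (auto intro: fps_vs.subspace_scale)
    then have per: "fps_nth h (k + M) = fps_nth h k" for k
      by (simp add: unit_periodic_def)
    have "dirichlet_character M (fps_nth h)"
    proof (rule dirichlet_characterI)
      show "fps_nth h (j * k) = fps_nth h j * fps_nth h k" for j k
        using M per norm h_eq by (intro normalised_eigenform_multiplicative(2)[of M "fps_nth h" 1]) simp_all
      show "fps_nth h 1 = 1"
        using norm by (simp add: normalised_eigenform_def)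
      show "fps_nth h p = 0" if "prime p" "p dvd M" for p
      proof -
        have "\<not> coprime p M"
          using that by (meson coprime_absorb_left not_prime_unit)
        then show ?thesis using h by (simp add: unit_periodic_def)
      qed
    qed (use M per in simp_all)
    then have "h \<in> character_fps M 1"
      using h_eq by (auto simp: character_fps_def)
    moreover have "g = fps_scale (fps_nth g 1) h"
      using False by (simp add: h_def)
    ultimately show ?thesis
      by (metis fps_vs.span_base fps_vs.span_scale)
  next
    case True
    have "fps_nth g k = 0" for k
    proof (cases "coprime k M")
      case True
      then obtain r where r: "r \<in> totatives M" "[k = r] (mod M)"
        using totative_representative M by blast
      then obtain c where "U_op r g = fps_scale c g"
        using g by blast
      then have "fps_nth (U_op r g) 1 = c * fps_nth g 1"
        by simp
      then show ?thesis
        using unit_periodic_cong[of g M k r] g r \<open>fps_nth g 1 = 0\<close> by simp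
    qed (use g in \<open>simp add: unit_periodic_def\<close>)
    then have "g = 0" by (simp add: fps_eq_iff)
    then show ?thesis by (simp add: fps_vs.span_zero)
  qed
  then have "fps_vs.span ?E \<subseteq> fps_vs.span (character_fps M 1)"
    by (intro fps_vs.span_minimal) auto
  then show ?thesis
    using unit_periodic_simultaneous[OF M, of "totatives M"] by (auto simp: in_totatives_iff)
qed

text \<open>The indicator functions of the residue classes coprime to \<open>M\<close> are a basis.\<close>
lemma dim_unit_periodic:
  assumes M: "M > 0"
  shows "fps_vs.dim (unit_periodic M) = totient M"
proof -
  define e :: "nat \<Rightarrow> complex fps" where "e r = Abs_fps (\<lambda>k. of_bool [k = r] (mod M))" for r
  have e_nth: "fps_nth (e r) s = of_bool (r = s)" if "r \<in> totatives M" "s \<in> totatives M" for r s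
    using totatives_cong_unique[of s M r] that by (auto simp: e_def)
  have inj: "inj_on e (totatives M)"
  proof (rule inj_onI)
    fix r s assume "r \<in> totatives M" "s \<in> totatives M" "e r = e s"
    then show "r = s"
      using e_nth[of r s] e_nth[of s s] by (auto split: if_splits)
  qed
  show ?thesis
  proof (rule fps_vs.dim_unique)
    show "e ` totatives M \<subseteq> unit_periodic M"
    proof
      fix f assume "f \<in> e ` totatives M"
      then obtain r where r: "f = e r" "coprime r M"
        by (auto simp: in_totatives_iff)
      have "\<not> [k = r] (mod M)" if "\<not> coprime k M" for k
        using that r(2) cong_imp_coprime[of r k M] cong_sym by blast
      then show "f \<in> unit_periodic M"
        by (auto simp: r e_def unit_periodic_def cong_def)
    qed
    show "unit_periodic M \<subseteq> fps_vs.span (e ` totatives M)"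
    proof
      fix f assume f: "f \<in> unit_periodic M"
      have "f = (\<Sum>r\<in>totatives M. fps_scale (fps_nth f r) (e r))"
      proof (rule fps_ext)
        fix k
        show "fps_nth f k = fps_nth (\<Sum>r\<in>totatives M. fps_scale (fps_nth f r) (e r)) k"
        proof (cases "coprime k M")
          case True
          then obtain s where s: "s \<in> totatives M" "[k = s] (mod M)"
            using totative_representative M by blast
          have "fps_nth (e r) k = of_bool (r = s)" if "r \<in> totatives M" for r
            using e_nth[OF that s(1)] s(2) by (simp add: e_def cong_def)
          then have "fps_nth (\<Sum>r\<in>totatives M. fps_scale (fps_nth f r) (e r)) k =
              (\<Sum>r\<in>totatives M. if r = s then fps_nth f r else 0)"
            unfolding fps_sum_nth by (intro sum.cong) auto
          also have "\<dots> = fps_nth f s"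
            using s(1) by simp
          finally show ?thesis
            using unit_periodic_cong[OF f s(2)] by simp
        next
          case False
          have "fps_nth (e r) k = 0" if "r \<in> totatives M" for r
            using False that cong_imp_coprime[of r k M]
            by (auto simp: e_def in_totatives_iff cong_sym_eq)
          then show ?thesis
            using False f by (simp add: fps_sum_nth unit_periodic_def)
        qed
      qed
      then show "f \<in> fps_vs.span (e ` totatives M)"
        by (metis (no_types, lifting) fps_vs.span_base fps_vs.span_scale fps_vs.span_sum imageI)
    qed
    show "fps_vs.independent (e ` totatives M)"
    proof (rule fps_vs.independent_if_scalars_zero)
      fix u g assume sum: "(\<Sum>x\<in>e ` totatives M. fps_scale (u x) x) = 0" and "g \<in> e ` totatives M"
      then obtain s where s: "g = e s" "s \<in> totatives M" by blast
      have "0 = fps_nth (\<Sum>r\<in>totatives M. fps_scale (u (e r)) (e r)) s"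
        using sum by (simp add: sum.reindex[OF inj])
      also have "\<dots> = (\<Sum>r\<in>totatives M. if r = s then u (e r) else 0)"
        unfolding fps_sum_nth by (intro sum.cong) (auto simp: e_nth s(2))
      also have "\<dots> = u g"
        using s by simp
      finally show "u g = 0" by simp
    qed simp
    show "card (e ` totatives M) = totient M"
      by (simp add: card_image[OF inj] totient_def)
  qed
qed

lemma inj_on_weighted_characters:
  assumes "M > 0"
  shows "inj_on (weighted_fps \<kappa>) {\<chi>. dirichlet_character M \<chi>}"
proof (rule inj_onI)
  fix \<chi> \<psi> assume *: "\<chi> \<in> {\<chi>. dirichlet_character M \<chi>}" "\<psi> \<in> {\<chi>. dirichlet_character M \<chi>}"
    and eq: "weighted_fps \<kappa> \<chi> = weighted_fps \<kappa> \<psi>"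
  have "\<chi> (k + M) = \<psi> (k + M)" for k
    using weighted_fps_eqD[OF eq] assms by simp
  then show "\<chi> = \<psi>"
    using * by (simp add: dirichlet_character_def fun_eq_iff)
qed

theorem card_character_fps:
  assumes M: "M > 0"
  shows "card (character_fps M \<kappa>) = totient M"
proof -
  have img: "character_fps M \<kappa> = weighted_fps \<kappa> ` {\<chi>. dirichlet_character M \<chi>}" for \<kappa>
    by (auto simp: character_fps_def)
  have "card (character_fps M \<kappa>) = card (character_fps M 1)"
    unfolding img by (simp add: card_image inj_on_weighted_characters[OF M])
  also have "\<dots> = fps_vs.dim (unit_periodic M)"
    using character_fps_subset_unit_periodic unit_periodic_subset_span_characters[OF M]
      independent_character_fps[OF M] by (intro fps_vs.dim_unique[symmetric]) auto
  also have "\<dots> = totient M"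
    by (rule dim_unit_periodic[OF M])
  finally show ?thesis .
qed

section \<open>The basis of characters\<close>

lemma unitary_divisor_dvd: "L > 0 \<Longrightarrow> M \<in> unitary_divisors L \<Longrightarrow> M dvd L"
  using unitary_part_complement by (auto simp: unitary_divisors_altdef) (metis dvd_triv_left)

lemma unitary_divisor_pos: "M \<in> unitary_divisors L \<Longrightarrow> M > 0"
  by (auto simp: unitary_divisors_altdef unitary_part_pos)

theorem basis_V_space:
  assumes L: "L > 0"
  shows "is_basis (\<Union>M\<in>unitary_divisors L. character_fps M \<kappa>) (V_space L \<kappa>)"
proof -
  let ?B = "\<Union>M\<in>unitary_divisors L. character_fps M \<kappa>"
  let ?E = "{f \<in> R_space L \<kappa>. \<forall>n\<ge>1. \<exists>c. U_op n f = fps_scale c f}"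
  have BR: "?B \<subseteq> R_space L \<kappa>"
    using character_fps_subset_R_space[OF L] unitary_divisor_dvd[OF L] by blast
  have norm: "normalised_eigenform f" if "f \<in> ?B" for f
    using that by (auto simp: character_fps_def normalised_eigenform_character)
  have BE: "?B \<subseteq> ?E"
    using BR norm unfolding normalised_eigenform_def by blast
  have "fps_vs.independent ?B"
  proof (rule independent_normalised_eigenforms)
    fix f g assume "f \<in> ?B" "g \<in> ?B" and eq: "\<And>n. n \<ge> 1 \<Longrightarrow> fps_nth f n = fps_nth g n"
    then show "f = g"
      using BR R_space_eqI[OF L, of f \<kappa> g] by blast
  qed (rule norm)
  moreover have "f \<in> fps_vs.span ?B" if f: "f \<in> ?E" for f
  proof (cases "fps_nth f 1 = 0")
    case True
    then have "f = 0"
      using joint_eigenfunction_eq_0[OF _ _ L] f by blast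
    then show ?thesis by (simp add: fps_vs.span_zero)
  next
    case False
    define h where "h = fps_scale (1 / fps_nth f 1) f"
    have "h \<in> R_space L \<kappa>"
      unfolding h_def using f by (intro R_space_scale L) simp
    then obtain a where a: "h = weighted_fps \<kappa> a" "\<And>k. a (k + L) = a k"
      by (auto simp: R_space_iff[OF L])
    have "normalised_eigenform h"
      unfolding h_def using f False by (intro normalise_joint_eigenfunction) auto
    then have "\<exists>M\<in>unitary_divisors L. dirichlet_character M a"
      using normalised_eigenform_multiplicative[of L a \<kappa>] a L
      by (intro completely_multiplicative_periodic) auto
    then have "h \<in> ?B"
      unfolding a(1) character_fps_def by blast
    moreover have "f = fps_scale (fps_nth f 1) h"
      using False by (simp add: h_def)
    ultimately show ?thesis
      by (metis fps_vs.span_base fps_vs.span_scale)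
  qed
  then have "?E \<subseteq> fps_vs.span ?B"
    by (rule subsetI)
  moreover have "?B \<subseteq> fps_vs.span ?E"
    using BE fps_vs.span_superset by (rule order_trans)
  ultimately show ?thesis
    unfolding is_basis_def V_space_def fps_vs.span_eq by (intro conjI)
qed

text \<open>
  A prime is a zero of a character exactly when it divides the modulus, and a unitary divisor of \<open>L\<close>
  is determined by its primes.
\<close>
lemma disjoint_character_fps:
  assumes "M \<in> unitary_divisors L" "N \<in> unitary_divisors L" "M \<noteq> N"
  shows "character_fps M \<kappa> \<inter> character_fps N \<kappa> = {}"
proof (rule ccontr)
  assume "\<not> ?thesis"
  then obtain \<chi> \<psi> where \<chi>: "dirichlet_character M \<chi>" and \<psi>: "dirichlet_character N \<psi>"
    and eq: "weighted_fps \<kappa> \<chi> = weighted_fps \<kappa> \<psi>"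
    by (auto simp: character_fps_def)
  obtain S T where S: "S \<subseteq> prime_factors L" "M = unitary_part L S"
    and T: "T \<subseteq> prime_factors L" "N = unitary_part L T"
    using assms by (auto simp: unitary_divisors_altdef)
  have "p \<in> S \<longleftrightarrow> p \<in> T" if "p \<in> prime_factors L" for p
  proof -
    have p: "prime p" using that by (simp add: in_prime_factors_iff)
    then have cop: "coprime p k \<longleftrightarrow> \<not> p dvd k" for k
      by (metis coprime_absorb_left not_prime_unit prime_imp_coprime)
    have "\<chi> p = \<psi> p"
      using weighted_fps_eqD[OF eq] p by (simp add: prime_gt_0_nat)
    moreover have "\<chi> p \<noteq> 0 \<longleftrightarrow> coprime p M" "\<psi> p \<noteq> 0 \<longleftrightarrow> coprime p N"
      using \<chi> \<psi> unfolding dirichlet_character_def by blast+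
    ultimately have "p dvd M \<longleftrightarrow> p dvd N"
      unfolding cop by metis
    then show ?thesis
      using S T prime_dvd_unitary_part_iff p by simp
  qed
  then have "S = T" using S(1) T(1) by blast
  then show False using S T assms(3) by simp
qed

section \<open>The dimension\<close>

theorem dim_V_space_sum:
  assumes L: "L > 0"
  shows "fps_vs.dim (V_space L \<kappa>) = (\<Sum>M\<in>unitary_divisors L. totient M)"
proof -
  let ?B = "\<Union>M\<in>unitary_divisors L. character_fps M \<kappa>"
  have "fps_vs.dim (V_space L \<kappa>) = card ?B"
    using basis_V_space[OF L, of \<kappa>] unfolding is_basis_def
    by (metis fps_vs.dim_span_eq_card_independent)
  also have "\<dots> = (\<Sum>M\<in>unitary_divisors L. card (character_fps M \<kappa>))"
  proof (rule card_UN_disjoint)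
    show "finite (unitary_divisors L)"
      by (simp add: unitary_divisors_altdef)
    show "\<forall>M\<in>unitary_divisors L. finite (character_fps M \<kappa>)"
      using card_character_fps unitary_divisor_pos by (metis card_ge_0_finite totient_gt_0_iff)
  qed (use disjoint_character_fps in blast)
  also have "\<dots> = (\<Sum>M\<in>unitary_divisors L. totient M)"
    by (intro sum.cong refl card_character_fps unitary_divisor_pos)
  finally show ?thesis .
qed

lemma totient_unitary_part:
  assumes "S \<subseteq> prime_factors L"
  shows "totient (unitary_part L S) = (\<Prod>p\<in>S. totient (p ^ multiplicity p L))"
proof -
  have "finite S" using assms by (rule finite_subset) simp
  then show ?thesis
    using assms
  proof (induction S rule: finite_induct)
    case (insert p S)
    have "coprime (p ^ multiplicity p L) (unitary_part L S)"
      unfolding unitary_part_def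
    proof (intro prod_coprime_right coprime_power_left_iff[THEN iffD2] disjI1 coprime_power_right_iff[THEN iffD2])
      fix q assume "q \<in> S"
      then show "coprime p q"
        using insert by (intro primes_coprime) (auto simp: in_prime_factors_iff)
    qed
    then show ?case
      using insert by (simp add: unitary_part_def totient_mult_coprime)
  qed (simp add: unitary_part_def)
qed

text \<open>
  Expanding the product: choosing the summand \<open>totient (p ^ \<dots>)\<close> for \<open>p\<close> in \<open>S\<close> and 1 otherwise gives the
  totient of the unitary divisor belonging to \<open>S\<close>.
\<close>
theorem dim_V_space_prod:
  assumes L: "L > 0"
  shows "fps_vs.dim (V_space L \<kappa>) =
    (\<Prod>p\<in>prime_factors L. (totient (p ^ multiplicity p L) + 1))"
proof -
  have "(\<Prod>p\<in>prime_factors L. (totient (p ^ multiplicity p L) + 1)) =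
      (\<Sum>S\<in>Pow (prime_factors L). \<Prod>p\<in>S. totient (p ^ multiplicity p L))"
    by (subst prod_add) simp_all
  also have "\<dots> = (\<Sum>S\<in>Pow (prime_factors L). totient (unitary_part L S))"
    by (intro sum.cong) (simp_all add: totient_unitary_part)
  also have "\<dots> = (\<Sum>M\<in>unitary_divisors L. totient M)"
    unfolding unitary_divisors_altdef by (simp add: sum.reindex[OF inj_on_unitary_part])
  also have "\<dots> = fps_vs.dim (V_space L \<kappa>)"
    by (simp add: dim_V_space_sum[OF L])
  finally show ?thesis by simp
qed

lemma multiplicative_prod_prime_powers:
  fixes g :: "nat \<Rightarrow> nat"
  shows "multiplicative_on_pos (\<lambda>L. \<Prod>p\<in>prime_factors L. g (p ^ multiplicity p L))"
  unfolding multiplicative_on_pos_def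
proof (intro conjI allI impI)
  fix a b :: nat assume ab: "a > 0" "b > 0" "coprime a b"
  have disj: "\<not> (p dvd a \<and> p dvd b)" if "prime p" for p
    using ab(3) that by (meson coprime_common_divisor not_prime_unit)
  then have disj': "\<not> p dvd a" if "prime p" "p dvd b" for p
    using that by blast
  have mult: "multiplicity p (a * b) = multiplicity p a + multiplicity p b" if "prime p" for p
    using ab that by (simp add: prime_elem_multiplicity_mult_distrib)
  have "(\<Prod>p\<in>prime_factors (a * b). g (p ^ multiplicity p (a * b))) =
      (\<Prod>p\<in>prime_factors a \<union> prime_factors b. g (p ^ multiplicity p (a * b)))"
    using ab by (simp add: prime_factors_product)
  also have "\<dots> = (\<Prod>p\<in>prime_factors a. g (p ^ multiplicity p (a * b))) *
      (\<Prod>p\<in>prime_factors b. g (p ^ multiplicity p (a * b)))"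
    using disj by (intro prod.union_disjoint) (auto simp: in_prime_factors_iff)
  also have "(\<Prod>p\<in>prime_factors a. g (p ^ multiplicity p (a * b))) =
      (\<Prod>p\<in>prime_factors a. g (p ^ multiplicity p a))"
    using disj by (intro prod.cong) (auto simp: in_prime_factors_iff mult not_dvd_imp_multiplicity_0)
  also have "(\<Prod>p\<in>prime_factors b. g (p ^ multiplicity p (a * b))) =
      (\<Prod>p\<in>prime_factors b. g (p ^ multiplicity p b))"
    using disj' by (intro prod.cong) (auto simp: in_prime_factors_iff mult not_dvd_imp_multiplicity_0)
  finally show "(\<Prod>p\<in>prime_factors (a * b). g (p ^ multiplicity p (a * b))) =
      (\<Prod>p\<in>prime_factors a. g (p ^ multiplicity p a)) *
      (\<Prod>p\<in>prime_factors b. g (p ^ multiplicity p b))" .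
qed simp

lemma prod_eq_imp_eq:
  fixes f g :: "'a \<Rightarrow> nat"
  assumes "finite A" "\<And>x. x \<in> A \<Longrightarrow> 0 < f x" "\<And>x. x \<in> A \<Longrightarrow> f x \<le> g x"
    and eq: "prod f A = prod g A" and x: "x \<in> A"
  shows "f x = g x"
proof (rule ccontr)
  assume "f x \<noteq> g x"
  then have "f x < g x" using assms by (simp add: le_neq_implies_less)
  moreover have "prod f (A - {x}) \<le> prod g (A - {x})"
    using assms by (intro prod_mono) auto
  moreover have "prod f (A - {x}) > 0"
    using assms by (intro prod_pos) auto
  ultimately have "f x * prod f (A - {x}) < g x * prod g (A - {x})"
    by (intro mult_less_le_imp_less) auto
  then show False
    using eq prod.remove[OF assms(1) x, of f] prod.remove[OF assms(1) x, of g] by simp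
qed

text \<open>The difference \<open>p ^ m - totient (p ^ m)\<close> is \<open>p ^ (m - 1)\<close>, which is 1 only for \<open>m = 1\<close>.\<close>
lemma totient_prime_power_plus_1:
  assumes "prime p" "m > 0"
  shows "totient (p ^ m) + 1 \<le> p ^ m" "totient (p ^ m) + 1 = p ^ m \<longleftrightarrow> m = 1"
proof -
  have p: "p > 1" using assms(1) by (rule prime_gt_1_nat)
  have "p ^ m = p ^ (m - 1) * p"
    using assms(2) by (cases m) simp_all
  moreover have "totient (p ^ m) = p ^ (m - 1) * (p - 1)"
    using assms by (rule totient_prime_power)
  ultimately have eq: "totient (p ^ m) + p ^ (m - 1) = p ^ m"
    using p by (simp add: diff_mult_distrib2)
  have pos: "p ^ (m - 1) > 0" using p by simp
  then show "totient (p ^ m) + 1 \<le> p ^ m" using eq by linarith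
  have "totient (p ^ m) + 1 = p ^ m \<longleftrightarrow> p ^ (m - 1) = 1"
    using eq by linarith
  also have "\<dots> \<longleftrightarrow> m = 1"
    using p assms(2) by (auto simp: nat_power_eq_Suc_0_iff)
  finally show "totient (p ^ m) + 1 = p ^ m \<longleftrightarrow> m = 1" .
qed

text \<open>
  Each factor of the product formula is at most the corresponding prime power in the factorization
  of \<open>L\<close>, so the products agree only if all factors do.
\<close>
theorem dim_V_space_eq_iff:
  assumes L: "L > 0"
  shows "fps_vs.dim (V_space L \<kappa>) = L \<longleftrightarrow> squarefree L"
proof -
  have prime: "prime p" "multiplicity p L > 0" if "p \<in> prime_factors L" for p
    using that by (auto simp: prime_factors_multiplicity)
  have L_eq: "L = (\<Prod>p\<in>prime_factors L. p ^ multiplicity p L)"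
    using prime_factorization_nat[OF L] .
  have "fps_vs.dim (V_space L \<kappa>) = L \<longleftrightarrow>
      (\<Prod>p\<in>prime_factors L. (totient (p ^ multiplicity p L) + 1)) =
      (\<Prod>p\<in>prime_factors L. p ^ multiplicity p L)"
    unfolding dim_V_space_prod[OF L] using L_eq by simp
  also have "\<dots> \<longleftrightarrow> (\<forall>p\<in>prime_factors L. totient (p ^ multiplicity p L) + 1 = p ^ multiplicity p L)"
  proof
    assume eq: "(\<Prod>p\<in>prime_factors L. (totient (p ^ multiplicity p L) + 1)) =
      (\<Prod>p\<in>prime_factors L. p ^ multiplicity p L)"
    show "\<forall>p\<in>prime_factors L. totient (p ^ multiplicity p L) + 1 = p ^ multiplicity p L"
      using prod_eq_imp_eq[OF _ _ _ eq] totient_prime_power_plus_1(1)[OF prime] by simp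
  qed (rule prod.cong[OF refl], simp)
  also have "\<dots> \<longleftrightarrow> (\<forall>p\<in>prime_factors L. multiplicity p L = 1)"
    using totient_prime_power_plus_1(2)[OF prime] by simp
  also have "\<dots> \<longleftrightarrow> squarefree L"
    using L by (simp add: squarefree_factorial_semiring')
  finally show ?thesis .
qed

theorem theorem14:
  fixes \<kappa> :: nat
  assumes "\<kappa> > 0"
  shows "(\<forall>L>0. is_basis (\<Union>M\<in>unitary_divisors L. character_fps M \<kappa>) (V_space L \<kappa>)) \<and>
    multiplicative_on_pos (\<lambda>L. fps_vs.dim (V_space L \<kappa>)) \<and>
    (\<forall>L>0. fps_vs.dim (V_space L \<kappa>) =
       (\<Prod>p\<in>prime_factors L. (totient (p ^ multiplicity p L) + 1))) \<and>
    (\<forall>L>0. fps_vs.dim (V_space L \<kappa>) = (\<Sum>M\<in>unitary_divisors L. totient M)) \<and>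
    (\<forall>L>0. fps_vs.dim (V_space L \<kappa>) = L \<longleftrightarrow> squarefree L)"
proof -
  have "multiplicative_on_pos (\<lambda>L. fps_vs.dim (V_space L \<kappa>))"
    using multiplicative_prod_prime_powers[of "\<lambda>q. totient q + 1"]
    by (simp add: multiplicative_on_pos_def dim_V_space_prod)
  then show ?thesis
    using basis_V_space dim_V_space_prod dim_V_space_sum dim_V_space_eq_iff by blast
qed

end
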